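(* Let $\mathcal{A}\in\mathbb{R}^{J_1\times J_2\times J_1\times J_2}$ and $\mathcal{B},\mathcal{C}^T\in\mathbb{R}^{J_1\times J_2\times K_1\times K_2}$, and let $\mathcal{V}_m,\mathcal{W}_m\in\mathbb{R}^{J_1\times J_2\times K_1\times mK_2}$ be the bi-orthonormal tensors produced by the tensor rational block Lanczos process (described in the context) applied to $(\mathcal{A},\mathcal{B},\mathcal{C})$. Set $$\mathcal{A}_m=\mathcal{W}_m^T*\mathcal{A}*\mathcal{V}_m,\qquad \mathcal{B}_m=\mathcal{W}_m^T*\mathcal{B},\qquad \mathcal{C}_m=\mathcal{C}*\mathcal{V}_m .$$ Let $s\in\mathbb{C}$ be such that $s\mathcal{I}-\mathcal{A}$ and $s\mathcal{I}_m-\mathcal{A}_m$ are invertible, let $\tilde{\mathcal{X}}_{\mathcal{B}}(s)$ and $\tilde{\mathcal{X}}_{\mathcal{C}}(s)$ be the solutions of $$(s\mathcal{I}_m-\mathcal{A}_m)*\tilde{\mathcal{X}}_{\mathcal{B}}(s)=\mathcal{B}_m,\qquad (s\mathcal{I}_m-\mathcal{A}_m)^T*\tilde{\mathcal{X}}_{\mathcal{C}}(s)=\mathcal{C}_m^T,$$ and let $$\mathcal{R}_{\mathcal{B}}(s)=\mathcal{B}-(s\mathcal{I}-\mathcal{A})*\mathcal{V}_m*\tilde{\mathcal{X}}_{\mathcal{B}}(s),\qquad \mathcal{R}_{\mathcal{C}}(s)=\mathcal{C}^T-(s\mathcal{I}-\mathcal{A})^T*\mathcal{W}_m*\tilde{\mathcal{X}}_{\mathcal{C}}(s)$$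 be the residual tensors, which satisfy the Petrov–Galerkin conditions $\mathcal{W}_m^T*\mathcal{R}_{\mathcal{B}}(s)=\mathcal{O}$ and $\mathcal{V}_m^T*\mathcal{R}_{\mathcal{C}}(s)=\mathcal{O}$. Then the error $\epsilon(s)=\mathcal{F}(s)-\mathcal{F}_m(s)$ between the transfer functions $$\mathcal{F}(s)=\mathcal{C}*(s\mathcal{I}-\mathcal{A})^{-1}*\mathcal{B},\qquad \mathcal{F}_m(s)=\mathcal{C}_m*(s\mathcal{I}_m-\mathcal{A}_m)^{-1}*\mathcal{B}_m$$ of the original and reduced-order systems is $$\epsilon(s)=\mathcal{R}_{\mathcal{C}}(s)^T*(s\mathcal{I}-\mathcal{A})^{-1}*\mathcal{R}_{\mathcal{B}}(s).$$
   Context: All tensors are 4th-order. For $\mathcal{X}$ of size $P_1\times P_2\times Q_1\times Q_2$ and $\mathcal{Y}$ of size $Q_1\times Q_2\times R_1\times R_2$, the Einstein product $\mathcal{X}*\mathcal{Y}$ has size $P_1\times P_2\times R_1\times R_2$ and entries $(\mathcal{X}*\mathcal{Y})_{p_1p_2r_1r_2}=\sum_{q_1,q_2}x_{p_1p_2q_1q_2}\,y_{q_1q_2r_1r_2}$. The transpose (without conjugation) is $(\mathcal{X}^T)_{q_1q_2p_1p_2}=x_{p_1p_2q_1q_2}$. The identity tensor has entries $1$ when $(p_1,p_2)=(q_1,q_2)$ and $0$ otherwise; $\mathcal{I}$ is the identity of size $J_1\times J_2\times J_1\times J_2$, $\mathcal{I}_m$ the identity of size $K_1\times mK_2\times K_1\times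 mK_2$, and $\mathcal{O}$ is a zero tensor. A square tensor (size $P_1\times P_2\times P_1\times P_2$) is invertible if it has a two-sided inverse for $*$. Block notation: $\mathcal{V}_k=|V_1\ \cdots\ V_k|\in\mathbb{R}^{J_1\times J_2\times K_1\times kK_2}$ is the concatenation of $V_1,\dots,V_k\in\mathbb{R}^{J_1\times J_2\times K_1\times K_2}$ along the fourth mode, i.e. $\mathcal{V}_k(:,:,:,(j-1)K_2+1:jK_2)=V_j$; similarly $\mathcal{W}_k=|W_1\ \cdots\ W_k|$. Tensor rational block Lanczos process (run without breakdown) with interpolation points $\sigma_1,\sigma_2,\dots$ (each $\mathcal{A}-\sigma_j\mathcal{I}$ invertible when $\sigma_j$ is finite): choose factorizations $(\mathcal{A}-\sigma_1\mathcal{I})^{-1}*\mathcal{B}=V_1*H_{1,0}$ and $(\mathcal{A}-\sigma_1\mathcal{I})^{-T}*\mathcal{C}^T=W_1*G_{1,0}$ with $W_1^T*V_1$ equal to the identity. For $k=1,2,\dots$: set $\mathcal{S}_k=(\mathcal{A}-\sigma_{k+1}\mathcal{I})^{-1}*V_k$ and $\mathcal{R}_k=(\mathcal{A}-\sigma_{k+1}\mathcal{I})^{-T}*W_k$ (or $\mathcal{S}_k=\mathcal{A}*V_k$, $\mathcal{R}_k=\mathcal{A}^T*W_k$ if $\sigma_{k+1}=\infty$); set $H_k=\mathcal{W}_k^T*\mathcal{S}_k$, $G_k=\mathcal{V}_k^T*\mathcal{R}_k$; then factor $\mathcal{S}_k-\mathcal{V}_k*H_k=V_{k+1}*H_{k+1,k}$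 and $\mathcal{R}_k-\mathcal{W}_k*G_k=W_{k+1}*G_{k+1,k}$ with $W_{k+1}^T*V_{k+1}$ equal to the identity (obtained by QR factorizations followed by rescaling using a singular value decomposition). The resulting tensors are bi-orthonormal: $\mathcal{W}_m^T*\mathcal{V}_m=\mathcal{I}_m$. *)

theory Defs
  imports Complex_Main "HOL-Library.FuncSet"
begin

text \<open>
  A fourth-order tensor is a size together with its entries. Indices start at 0, and entries
  outside the size are \<open>undefined\<close>, so that tensors of equal size with equal entries are equal.
\<close>

definition index_set :: "nat \<times> nat \<times> nat \<times> nat \<Rightarrow> (nat \<times> nat \<times> nat \<times> nat) set" where
  "index_set = (\<lambda>(P1, P2, Q1, Q2). {..<P1} \<times> {..<P2} \<times> {..<Q1} \<times> {..<Q2})"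

typedef 'a tensor4 =
  "{(d, f :: nat \<times> nat \<times> nat \<times> nat \<Rightarrow> 'a). f \<in> extensional (index_set d)}"
  by (rule exI[of _ "((0, 0, 0, 0), \<lambda>_. undefined)"]) (simp add: extensional_def)

setup_lifting type_definition_tensor4

lift_definition tsize :: "'a tensor4 \<Rightarrow> nat \<times> nat \<times> nat \<times> nat" is fst .

lift_definition entry :: "'a tensor4 \<Rightarrow> nat \<times> nat \<times> nat \<times> nat \<Rightarrow> 'a" (infixl "$$" 100) is snd .

lift_definition mk_tensor ::
  "nat \<times> nat \<times> nat \<times> nat \<Rightarrow> (nat \<times> nat \<times> nat \<times> nat \<Rightarrow> 'a) \<Rightarrow> 'a tensor4"
  is "\<lambda>d f. (d, restrict f (index_set d))" by simp

lemma tsize_mk_tensor [simp]: "tsize (mk_tensor d f) = d"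
  by transfer simp

lemma entry_mk_tensor [simp]: "i \<in> index_set d \<Longrightarrow> mk_tensor d f $$ i = f i"
  by transfer simp

lemma tensor4_eqI:
  assumes "tsize X = tsize Y" and "\<And>i. i \<in> index_set (tsize Y) \<Longrightarrow> X $$ i = Y $$ i"
  shows "X = Y"
  using assms by transfer (auto intro: extensionalityI simp: prod_eq_iff)

definition tensors :: "nat \<Rightarrow> nat \<Rightarrow> nat \<Rightarrow> nat \<Rightarrow> 'a tensor4 set" where
  "tensors P1 P2 Q1 Q2 = {X. tsize X = (P1, P2, Q1, Q2)}"

text \<open>
  The product \<open>X * Y\<close> is the Einstein product; it is meaningful only when the last two modes of
  \<open>X\<close> match the first two modes of \<open>Y\<close>. Likewise \<open>X - Y\<close> presupposes equal sizes.
\<close>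

instantiation tensor4 :: ("{comm_monoid_add, times}") times
begin

definition times_tensor4 :: "'a tensor4 \<Rightarrow> 'a tensor4 \<Rightarrow> 'a tensor4" where
  "X * Y = (let (P1, P2, Q1, Q2) = tsize X; (_, _, R1, R2) = tsize Y in
     mk_tensor (P1, P2, R1, R2)
       (\<lambda>(p1, p2, r1, r2). \<Sum>q1<Q1. \<Sum>q2<Q2. X $$ (p1, p2, q1, q2) * Y $$ (q1, q2, r1, r2)))"

instance ..

end

instantiation tensor4 :: (minus) minus
begin

definition minus_tensor4 :: "'a tensor4 \<Rightarrow> 'a tensor4 \<Rightarrow> 'a tensor4" where
  "X - Y = mk_tensor (tsize X) (\<lambda>i. X $$ i - Y $$ i)"

instance ..

end

definition tscale :: "'a::times \<Rightarrow> 'a tensor4 \<Rightarrow> 'a tensor4" (infixr "\<cdot>" 75) where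
  "c \<cdot> X = mk_tensor (tsize X) (\<lambda>i. c * X $$ i)"

definition ttranspose :: "'a tensor4 \<Rightarrow> 'a tensor4" ("_\<^sup>T" [1000] 1000) where
  "X\<^sup>T = (let (P1, P2, Q1, Q2) = tsize X in
     mk_tensor (Q1, Q2, P1, P2) (\<lambda>(q1, q2, p1, p2). X $$ (p1, p2, q1, q2)))"

definition tident :: "nat \<Rightarrow> nat \<Rightarrow> 'a::zero_neq_one tensor4" where
  "tident P1 P2 = mk_tensor (P1, P2, P1, P2)
     (\<lambda>(p1, p2, q1, q2). if (p1, p2) = (q1, q2) then 1 else 0)"

definition tzero :: "nat \<Rightarrow> nat \<Rightarrow> nat \<Rightarrow> nat \<Rightarrow> 'a::zero tensor4" where
  "tzero P1 P2 Q1 Q2 = mk_tensor (P1, P2, Q1, Q2) (\<lambda>_. 0)"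

definition is_tinverse :: "'a::semiring_1 tensor4 \<Rightarrow> 'a tensor4 \<Rightarrow> bool" where
  "is_tinverse X Y \<longleftrightarrow> (\<exists>P1 P2. X \<in> tensors P1 P2 P1 P2 \<and> Y \<in> tensors P1 P2 P1 P2 \<and>
     X * Y = tident P1 P2 \<and> Y * X = tident P1 P2)"

definition tinvertible :: "'a::semiring_1 tensor4 \<Rightarrow> bool" where
  "tinvertible X \<longleftrightarrow> (\<exists>Y. is_tinverse X Y)"

definition tinv :: "'a::semiring_1 tensor4 \<Rightarrow> 'a tensor4" where
  "tinv X = (THE Y. is_tinverse X Y)"

definition complex_tensor :: "real tensor4 \<Rightarrow> complex tensor4" where
  "complex_tensor X = mk_tensor (tsize X) (\<lambda>i. complex_of_real (X $$ i))"

text \<open>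
  The concatenation \<open>|V 1 ... V k|\<close> along the fourth mode; the common size of the blocks is read
  off from \<open>V 1\<close>.
\<close>

definition tconcat :: "nat \<Rightarrow> (nat \<Rightarrow> 'a tensor4) \<Rightarrow> 'a tensor4" where
  "tconcat k V = (let (P1, P2, Q1, Q2) = tsize (V 1) in
     mk_tensor (P1, P2, Q1, k * Q2)
       (\<lambda>(p1, p2, q1, q2). V (q2 div Q2 + 1) $$ (p1, p2, q1, q2 mod Q2)))"

datatype interp_point = Finite real | Infinity

text \<open>
  The operator applied to the last right block in one step; the left blocks use its transpose.
\<close>

fun krylov_op :: "nat \<Rightarrow> nat \<Rightarrow> real tensor4 \<Rightarrow> interp_point \<Rightarrow> real tensor4" where
  "krylov_op J1 J2 A (Finite x) = tinv (A - x \<cdot> tident J1 J2)"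
| "krylov_op J1 J2 A Infinity = A"

text \<open>
  \<open>V\<close>, \<open>W\<close>, \<open>H\<close>, \<open>G\<close> record a run of the tensor rational block Lanczos process up to the blocks
  \<open>V m\<close> and \<open>W m\<close>. The blocks and the points \<open>\<sigma>\<close> are indexed from 1. Only the factors
  \<open>H (k + 1) k\<close> and \<open>G (k + 1) k\<close> are recorded in \<open>H\<close> and \<open>G\<close>; \<open>Hk\<close> and \<open>Gk\<close> are the tall tensors
  \<open>H_k\<close> and \<open>G_k\<close>. The factorizations are not tied to a particular algorithm (such as QR followed
  by an SVD rescaling). Absence of breakdown means that all factors \<open>H (k + 1) k\<close> and
  \<open>G (k + 1) k\<close> with \<open>k \<ge> 1\<close> are invertible. Bi-orthogonality of different blocks is a consequence,
  not a requirement.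
\<close>

definition rational_block_lanczos ::
  "nat \<Rightarrow> nat \<Rightarrow> nat \<Rightarrow> nat \<Rightarrow> real tensor4 \<Rightarrow> real tensor4 \<Rightarrow> real tensor4 \<Rightarrow>
   (nat \<Rightarrow> interp_point) \<Rightarrow> nat \<Rightarrow> (nat \<Rightarrow> real tensor4) \<Rightarrow> (nat \<Rightarrow> real tensor4) \<Rightarrow>
   (nat \<Rightarrow> nat \<Rightarrow> real tensor4) \<Rightarrow> (nat \<Rightarrow> nat \<Rightarrow> real tensor4) \<Rightarrow> bool" where
  "rational_block_lanczos J1 J2 K1 K2 A B C \<sigma> m V W H G \<longleftrightarrow>
     \<sigma> 1 \<noteq> Infinity \<and>
     (\<forall>j\<in>{1..m}. \<forall>x. \<sigma> j = Finite x \<longrightarrow> tinvertible (A - x \<cdot> tident J1 J2)) \<and>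
     (\<forall>k\<in>{1..m}. V k \<in> tensors J1 J2 K1 K2 \<and> W k \<in> tensors J1 J2 K1 K2 \<and>
        (W k)\<^sup>T * V k = tident K1 K2) \<and>
     (\<forall>k\<in>{0..<m}. H (k + 1) k \<in> tensors K1 K2 K1 K2 \<and> G (k + 1) k \<in> tensors K1 K2 K1 K2) \<and>
     krylov_op J1 J2 A (\<sigma> 1) * B = V 1 * H 1 0 \<and>
     (krylov_op J1 J2 A (\<sigma> 1))\<^sup>T * C\<^sup>T = W 1 * G 1 0 \<and>
     (\<forall>k\<in>{1..<m}.
        let S = krylov_op J1 J2 A (\<sigma> (k + 1)) * V k;
            R = (krylov_op J1 J2 A (\<sigma> (k + 1)))\<^sup>T * W k;
            Hk = (tconcat k W)\<^sup>T * S;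
            Gk = (tconcat k V)\<^sup>T * R
        in S - tconcat k V * Hk = V (k + 1) * H (k + 1) k \<and>
           R - tconcat k W * Gk = W (k + 1) * G (k + 1) k \<and>
           tinvertible (H (k + 1) k) \<and> tinvertible (G (k + 1) k))"

definition transfer_function ::
  "nat \<Rightarrow> nat \<Rightarrow> real tensor4 \<Rightarrow> real tensor4 \<Rightarrow> real tensor4 \<Rightarrow> complex \<Rightarrow> complex tensor4" where
  "transfer_function P1 P2 A B C s =
     complex_tensor C * tinv (s \<cdot> tident P1 P2 - complex_tensor A) * complex_tensor B"

end

theory Submission
  imports Defs
begin

text \<open>
  As for matrices, bi-orthonormality of the blocks follows by induction along the process, because
  \<open>S - V\<^sub>k * (W\<^sub>k\<^sup>T * S)\<close> is annihilated by \<open>W\<^sub>k\<^sup>T\<close> once \<open>W\<^sub>k\<^sup>T * V\<^sub>k\<close> is the identity, and the factor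
  \<open>H\<^bsub>k+1,k\<^esub>\<close> can be cancelled. Hence \<open>s I\<^sub>m - A\<^sub>m = W\<^sub>m\<^sup>T * (s I - A) * V\<^sub>m\<close>, which gives the
  Petrov--Galerkin conditions. Expanding \<open>R\<^sub>C\<^sup>T * (s I - A)\<^sup>-\<^sup>1 * R\<^sub>B\<close>, the part
  \<open>X\<^sub>C\<^sup>T * W\<^sub>m\<^sup>T * R\<^sub>B\<close> vanishes and what is left is \<open>C * (s I - A)\<^sup>-\<^sup>1 * B - C\<^sub>m * X\<^sub>B\<close>.
\<close>

section \<open>Tensors as matrices indexed by pairs\<close>

text \<open>The first two modes act as one row index and the last two as one column index, both
  ranging over pairs. In this reading the Einstein product is the ordinary matrix product, and all
  tensor identities become matrix identities.\<close>

definition rdim :: "'a tensor4 \<Rightarrow> nat \<times> nat" where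
  "rdim X = (fst (tsize X), fst (snd (tsize X)))"

definition cdim :: "'a tensor4 \<Rightarrow> nat \<times> nat" where
  "cdim X = snd (snd (tsize X))"

definition box :: "nat \<times> nat \<Rightarrow> (nat \<times> nat) set" where
  "box d = {..<fst d} \<times> {..<snd d}"

text \<open>Quadruples are nested to the right, so the column pair \<open>q\<close> is the tail of
  the index and needs no unpacking.\<close>

definition ent :: "'a tensor4 \<Rightarrow> nat \<times> nat \<Rightarrow> nat \<times> nat \<Rightarrow> 'a" where
  "ent X p q = X $$ (fst p, snd p, q)"

lemma finite_box [simp]: "finite (box d)"
  by (simp add: box_def)

lemma tensors_iff: "X \<in> tensors P1 P2 Q1 Q2 \<longleftrightarrow> rdim X = (P1, P2) \<and> cdim X = (Q1, Q2)"
  by (auto simp: tensors_def rdim_def cdim_def prod_eq_iff)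

lemma tensor_eqI:
  assumes "rdim X = rdim Y" "cdim X = cdim Y"
    and "\<And>p q. p \<in> box (rdim Y) \<Longrightarrow> q \<in> box (cdim Y) \<Longrightarrow> ent X p q = ent Y p q"
  shows "X = Y"
proof (rule tensor4_eqI)
  show "tsize X = tsize Y"
    using assms(1,2) by (auto simp: rdim_def cdim_def prod_eq_iff)
  show "X $$ i = Y $$ i" if "i \<in> index_set (tsize Y)" for i
    using that assms(3)[of "(fst i, fst (snd i))" "snd (snd i)"]
    by (auto simp: index_set_def box_def ent_def rdim_def cdim_def split: prod.splits)
qed

section \<open>Row and column sizes of the tensor operations\<close>

lemma dim_times [simp]: "rdim (X * Y) = rdim X" "cdim (X * Y) = cdim Y"
  by (auto simp: times_tensor4_def rdim_def cdim_def split: prod.splits)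

lemma dim_minus [simp]: "rdim (X - Y) = rdim X" "cdim (X - Y) = cdim X"
  by (auto simp: minus_tensor4_def rdim_def cdim_def)

lemma dim_tscale [simp]: "rdim (c \<cdot> X) = rdim X" "cdim (c \<cdot> X) = cdim X"
  by (auto simp: tscale_def rdim_def cdim_def)

lemma dim_ttranspose [simp]: "rdim (X\<^sup>T) = cdim X" "cdim (X\<^sup>T) = rdim X"
  by (auto simp: ttranspose_def rdim_def cdim_def split: prod.splits)

lemma dim_tident [simp]: "rdim (tident P1 P2) = (P1, P2)" "cdim (tident P1 P2) = (P1, P2)"
  by (auto simp: tident_def rdim_def cdim_def)

lemma dim_tzero [simp]: "rdim (tzero P1 P2 Q1 Q2) = (P1, P2)" "cdim (tzero P1 P2 Q1 Q2) = (Q1, Q2)"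
  by (auto simp: tzero_def rdim_def cdim_def)

lemma dim_complex_tensor [simp]:
  "rdim (complex_tensor X) = rdim X" "cdim (complex_tensor X) = cdim X"
  by (auto simp: complex_tensor_def rdim_def cdim_def)

lemma dim_tconcat [simp]:
  "rdim (tconcat k V) = rdim (V 1)"
  "cdim (tconcat k V) = (fst (cdim (V 1)), k * snd (cdim (V 1)))"
  by (auto simp: tconcat_def rdim_def cdim_def split: prod.splits)

text \<open>The double sum over the two contracted modes is merged into one sum over the box of
  pairs; from here on products are treated as matrix products.\<close>

lemma ent_times:
  assumes "p \<in> box (rdim X)" "q \<in> box (cdim Y)"
  shows "ent (X * Y) p q = (\<Sum>r\<in>box (cdim X). ent X p r * ent Y r q)"
  using assms
  by (cases p; cases q; cases "tsize X"; cases "tsize Y")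
    (auto simp: times_tensor4_def ent_def box_def rdim_def cdim_def index_set_def
       sum.cartesian_product case_prod_beta)

lemma ent_minus:
  assumes "p \<in> box (rdim X)" "q \<in> box (cdim X)"
  shows "ent (X - Y) p q = ent X p q - ent Y p q"
  using assms
  by (cases p; cases q; cases "tsize X")
    (auto simp: minus_tensor4_def ent_def box_def rdim_def cdim_def index_set_def)

lemma ent_tscale:
  assumes "p \<in> box (rdim X)" "q \<in> box (cdim X)"
  shows "ent (c \<cdot> X) p q = c * ent X p q"
  using assms
  by (cases p; cases q; cases "tsize X")
    (auto simp: tscale_def ent_def box_def rdim_def cdim_def index_set_def)

lemma ent_ttranspose:
  assumes "p \<in> box (cdim X)" "q \<in> box (rdim X)"
  shows "ent (X\<^sup>T) p q = ent X q p"
  using assms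
  by (cases p; cases q; cases "tsize X")
    (auto simp: ttranspose_def ent_def box_def rdim_def cdim_def index_set_def)

lemma ent_tident:
  assumes "p \<in> box (P1, P2)" "q \<in> box (P1, P2)"
  shows "ent (tident P1 P2) p q = (if p = q then 1 else 0)"
  using assms
  by (cases p; cases q) (auto simp: tident_def ent_def box_def index_set_def)

lemma ent_tzero:
  assumes "p \<in> box (P1, P2)" "q \<in> box (Q1, Q2)"
  shows "ent (tzero P1 P2 Q1 Q2) p q = 0"
  using assms
  by (cases p; cases q) (auto simp: tzero_def ent_def box_def index_set_def)

lemma ent_complex_tensor:
  assumes "p \<in> box (rdim X)" "q \<in> box (cdim X)"
  shows "ent (complex_tensor X) p q = complex_of_real (ent X p q)"
  using assms
  by (cases p; cases q; cases "tsize X")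
    (auto simp: complex_tensor_def ent_def box_def rdim_def cdim_def index_set_def)

text \<open>The quotient by \<open>K2\<close> selects the block and the remainder the position
  inside it; the \<open>+ 1\<close> is there because blocks are numbered from 1 but indices from
  0.\<close>

lemma ent_tconcat:
  assumes "p \<in> box (rdim (V 1))" "cdim (V 1) = (K1, K2)" "q1 < K1" "q2 < k * K2"
  shows "ent (tconcat k V) p (q1, q2) = ent (V (q2 div K2 + 1)) p (q1, q2 mod K2)"
  using assms
  by (cases p; cases "tsize (V 1)")
    (auto simp: tconcat_def ent_def box_def rdim_def cdim_def index_set_def)

lemmas ent_simps = ent_times ent_minus ent_tscale ent_ttranspose ent_tident ent_tzero
  ent_complex_tensor

section \<open>Algebra of the Einstein product\<close>

lemma times_assoc:
  fixes X Y Z :: "'a::comm_ring_1 tensor4"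
  assumes "cdim X = rdim Y" "cdim Y = rdim Z"
  shows "X * Y * Z = X * (Y * Z)"
proof (rule tensor_eqI)
  fix p q assume "p \<in> box (rdim (X * (Y * Z)))" "q \<in> box (cdim (X * (Y * Z)))"
  then show "ent (X * Y * Z) p q = ent (X * (Y * Z)) p q"
    \<comment> \<open>Both sides expand to double sums of the same triple products, in opposite
      orders of summation.\<close>
    using assms by (simp add: ent_simps sum_distrib_left sum_distrib_right mult.assoc)
      (rule sum.swap)
qed simp_all

lemma times_minus_distrib_left:
  fixes X Y Z :: "'a::comm_ring_1 tensor4"
  assumes "cdim X = rdim Y" "rdim Z = rdim Y" "cdim Z = cdim Y"
  shows "X * (Y - Z) = X * Y - X * Z"
  by (rule tensor_eqI) (use assms in \<open>simp_all add: ent_simps right_diff_distrib sum_subtractf\<close>)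

lemma times_minus_distrib_right:
  fixes X Y Z :: "'a::comm_ring_1 tensor4"
  assumes "cdim Y = rdim X" "rdim Z = rdim Y" "cdim Z = cdim Y"
  shows "(Y - Z) * X = Y * X - Z * X"
  by (rule tensor_eqI) (use assms in \<open>simp_all add: ent_simps left_diff_distrib sum_subtractf\<close>)

lemma tscale_times:
  fixes X Y :: "'a::comm_ring_1 tensor4"
  assumes "cdim X = rdim Y"
  shows "(c \<cdot> X) * Y = c \<cdot> (X * Y)"
  by (rule tensor_eqI) (use assms in \<open>simp_all add: ent_simps sum_distrib_left mult.assoc\<close>)

lemma times_tscale:
  fixes X Y :: "'a::comm_ring_1 tensor4"
  assumes "cdim X = rdim Y"
  shows "X * (c \<cdot> Y) = c \<cdot> (X * Y)"
  by (rule tensor_eqI) (use assms in \<open>simp_all add: ent_simps sum_distrib_left mult.left_commute\<close>)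

lemma times_tident [simp]:
  fixes X :: "'a::comm_ring_1 tensor4"
  assumes "cdim X = (P1, P2)"
  shows "X * tident P1 P2 = X"
  by (rule tensor_eqI) (use assms in \<open>simp_all add: ent_simps if_distrib cong: if_cong\<close>)

lemma tident_times [simp]:
  fixes X :: "'a::comm_ring_1 tensor4"
  assumes "rdim X = (P1, P2)"
  shows "tident P1 P2 * X = X"
  by (rule tensor_eqI)
    (use assms in \<open>simp_all add: ent_simps if_distrib if_distribR cong: if_cong\<close>)

lemma tzero_times:
  fixes X :: "'a::comm_ring_1 tensor4"
  assumes "rdim X = (Q1, Q2)" "cdim X = (R1, R2)"
  shows "tzero P1 P2 Q1 Q2 * X = tzero P1 P2 R1 R2"
  by (rule tensor_eqI) (use assms in \<open>simp_all add: ent_simps\<close>)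

lemma times_tzero:
  fixes X :: "'a::comm_ring_1 tensor4"
  assumes "rdim X = (P1, P2)" "cdim X = (Q1, Q2)"
  shows "X * tzero Q1 Q2 R1 R2 = tzero P1 P2 R1 R2"
  by (rule tensor_eqI) (use assms in \<open>simp_all add: ent_simps\<close>)

lemma minus_self:
  fixes X :: "'a::comm_ring_1 tensor4"
  assumes "rdim X = (P1, P2)" "cdim X = (Q1, Q2)"
  shows "X - X = tzero P1 P2 Q1 Q2"
  by (rule tensor_eqI) (use assms in \<open>simp_all add: ent_simps\<close>)

lemma minus_tzero:
  fixes X :: "'a::comm_ring_1 tensor4"
  assumes "rdim X = (P1, P2)" "cdim X = (Q1, Q2)"
  shows "X - tzero P1 P2 Q1 Q2 = X"
  by (rule tensor_eqI) (use assms in \<open>simp_all add: ent_simps\<close>)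

section \<open>Transposition and passage to complex entries\<close>

lemma ttranspose_ttranspose [simp]: "(X\<^sup>T)\<^sup>T = X"
  by (rule tensor_eqI) (simp_all add: ent_simps)

lemma ttranspose_times:
  fixes X Y :: "'a::comm_ring_1 tensor4"
  assumes "cdim X = rdim Y"
  shows "(X * Y)\<^sup>T = Y\<^sup>T * X\<^sup>T"
  by (rule tensor_eqI) (use assms in \<open>simp_all add: ent_simps mult.commute\<close>)

lemma ttranspose_minus:
  assumes "rdim X = rdim Y" "cdim X = cdim Y"
  shows "(X - Y)\<^sup>T = X\<^sup>T - Y\<^sup>T"
  by (rule tensor_eqI) (use assms in \<open>simp_all add: ent_simps\<close>)

lemma ttranspose_tident [simp]: "(tident P1 P2)\<^sup>T = tident P1 P2"
  by (rule tensor_eqI) (auto simp: ent_simps)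

lemma ttranspose_tzero [simp]: "(tzero P1 P2 Q1 Q2)\<^sup>T = tzero Q1 Q2 P1 P2"
  by (rule tensor_eqI) (auto simp: ent_simps)

lemma complex_tensor_times:
  assumes "cdim X = rdim Y"
  shows "complex_tensor (X * Y) = complex_tensor X * complex_tensor Y"
  by (rule tensor_eqI) (use assms in \<open>simp_all add: ent_simps\<close>)

lemma complex_tensor_ttranspose: "complex_tensor (X\<^sup>T) = (complex_tensor X)\<^sup>T"
  by (rule tensor_eqI) (simp_all add: ent_simps)

lemma complex_tensor_tident: "complex_tensor (tident P1 P2) = tident P1 P2"
  by (rule tensor_eqI) (simp_all add: ent_simps)

section \<open>Inverses and cancellation\<close>

lemma is_tinverse_unique:
  fixes X :: "'a::comm_ring_1 tensor4"
  assumes "is_tinverse X Y" "is_tinverse X Z"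
  shows "Y = Z"
proof -
  from assms obtain P1 P2 where *: "rdim X = (P1, P2)" "cdim X = (P1, P2)"
      "rdim Y = (P1, P2)" "cdim Y = (P1, P2)" "rdim Z = (P1, P2)" "cdim Z = (P1, P2)"
      "Y * X = tident P1 P2" "X * Z = tident P1 P2"
    by (auto simp: is_tinverse_def tensors_iff)
  have "Y = Y * (X * Z)"
    using * by simp
  also have "\<dots> = Y * X * Z"
    using * by (subst times_assoc) simp_all
  also have "\<dots> = Z"
    using * by simp
  finally show ?thesis .
qed

text \<open>Uniqueness of inverses turns the definite description behind \<open>tinv\<close> into an
  actual inverse. Only square tensors are invertible, so the row size determines all other
  sizes.\<close>

lemma tinv:
  fixes X :: "'a::comm_ring_1 tensor4"
  assumes "tinvertible X" "rdim X = (P1, P2)"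
  shows "rdim (tinv X) = (P1, P2)" "cdim (tinv X) = (P1, P2)" "cdim X = (P1, P2)"
    "X * tinv X = tident P1 P2" "tinv X * X = tident P1 P2"
proof -
  obtain Y where Y: "is_tinverse X Y"
    using assms(1) by (auto simp: tinvertible_def)
  have "is_tinverse X (tinv X)"
    unfolding tinv_def by (rule theI[of "is_tinverse X", OF Y]) (rule is_tinverse_unique[OF _ Y])
  then show "rdim (tinv X) = (P1, P2)" "cdim (tinv X) = (P1, P2)" "cdim X = (P1, P2)"
    "X * tinv X = tident P1 P2" "tinv X * X = tident P1 P2"
    using assms(2) by (auto simp: is_tinverse_def tensors_iff)
qed

lemma tinv_times_eqI:
  fixes X :: "'a::comm_ring_1 tensor4"
  assumes "tinvertible X" "rdim X = rdim Y" "X * Y = Z"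
  shows "tinv X * Z = Y"
proof -
  obtain P1 P2 where P: "rdim X = (P1, P2)"
    by fastforce
  note i = tinv[OF assms(1) P]
  have Y: "rdim Y = (P1, P2)"
    using assms(2) P by simp
  have "tinv X * Z = tinv X * X * Y"
    unfolding assms(3)[symmetric] using Y P i by (subst times_assoc) simp_all
  then show ?thesis
    using Y i by simp
qed

text \<open>Multiplication by \<open>tinv Y\<close> from the right cancels \<open>Y\<close>. This is
  how the absence of breakdown enters the orthogonality argument.\<close>

lemma times_tinvertible_eq_tzero:
  fixes X Y :: "'a::comm_ring_1 tensor4"
  assumes "tinvertible Y" "rdim X = (P1, P2)" "cdim X = (Q1, Q2)" "rdim Y = (Q1, Q2)"
    and "X * Y = tzero P1 P2 Q1 Q2"
  shows "X = tzero P1 P2 Q1 Q2"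
proof -
  note i = tinv[OF assms(1,4)]
  have "X = X * Y * tinv Y"
    using assms(2-4) i by (simp add: times_assoc)
  then show ?thesis
    using assms(5) i by (simp add: tzero_times)
qed

section \<open>Bi-orthonormality of the Lanczos blocks\<close>

text \<open>The product contracts the first two modes, while concatenation happens along the fourth,
  which stays free. So each row of the product involves a single block.\<close>

lemma tconcat_transpose_times:
  fixes V :: "nat \<Rightarrow> 'a::comm_ring_1 tensor4"
  assumes V: "\<And>i. i \<in> {1..k} \<Longrightarrow> V i \<in> tensors J1 J2 K1 K2" and k: "k \<ge> 1"
    and X: "rdim X = (J1, J2)" and q: "q \<in> box (cdim X)" and p: "p1 < K1" "p2 < k * K2"
  shows "ent ((tconcat k V)\<^sup>T * X) (p1, p2) q = ent ((V (p2 div K2 + 1))\<^sup>T * X) (p1, p2 mod K2) q"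
proof -
  have "p2 div K2 < k"
    using p(2) by (simp add: less_mult_imp_div_less)
  then have 1: "rdim (V (p2 div K2 + 1)) = (J1, J2)" "cdim (V (p2 div K2 + 1)) = (K1, K2)"
    using V[of "p2 div K2 + 1"] by (auto simp: tensors_iff)
  have 2: "rdim (V 1) = (J1, J2)" "cdim (V 1) = (K1, K2)"
    using V[of 1] k by (auto simp: tensors_iff)
  \<comment> \<open>If \<open>K2 = 0\<close>, the bound \<open>p2 < k * K2\<close> would be
    impossible.\<close>
  have "p2 mod K2 < K2"
    using p(2) by (cases "K2 = 0") auto
  then have "(p1, p2) \<in> box (K1, k * K2)" "(p1, p2 mod K2) \<in> box (K1, K2)"
    using p by (auto simp: box_def)
  then show ?thesis
    using 1 2 X q p by (simp add: ent_times ent_ttranspose ent_tconcat[of _ _ K1 K2])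
qed

text \<open>The rows belonging to block \<open>i\<close> form a slice of the tall product, so they
  vanish with it.\<close>

lemma transpose_times_eq_tzero_of_tconcat:
  fixes W :: "nat \<Rightarrow> 'a::comm_ring_1 tensor4"
  assumes W: "\<And>i. i \<in> {1..k} \<Longrightarrow> W i \<in> tensors J1 J2 K1 K2"
    and X: "X \<in> tensors J1 J2 L1 L2"
    and 0: "(tconcat k W)\<^sup>T * X = tzero K1 (k * K2) L1 L2" and i: "i \<in> {1..k}"
  shows "(W i)\<^sup>T * X = tzero K1 K2 L1 L2"
proof (rule tensor_eqI)
  fix p q assume pq: "p \<in> box (rdim (tzero K1 K2 L1 L2 :: 'a tensor4))"
    "q \<in> box (cdim (tzero K1 K2 L1 L2 :: 'a tensor4))"
  obtain p1 p2 where p: "p = (p1, p2)" "p1 < K1" "p2 < K2"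
    using pq by (auto simp: box_def)
  \<comment> \<open>The position of index \<open>p2\<close> of block \<open>i\<close> inside the
    concatenation: the first block starts at offset 0.\<close>
  define r where "r = (i - 1) * K2 + p2"
  have "r < (i - 1) * K2 + K2"
    using p by (simp add: r_def)
  also have "\<dots> = i * K2"
    using i by (cases i) auto
  also have "\<dots> \<le> k * K2"
    using i by simp
  finally have r: "r < k * K2" "r div K2 + 1 = i" "r mod K2 = p2"
    using p i by (auto simp: r_def)
  have "ent ((W i)\<^sup>T * X) p q = ent ((tconcat k W)\<^sup>T * X) (p1, r) q"
    unfolding r(2,3)[symmetric] p(1) using i X pq p r
    by (intro tconcat_transpose_times[OF W, symmetric]) (auto simp: tensors_iff)
  also have "\<dots> = 0"
    unfolding 0 using p r pq by (intro ent_tzero) (auto simp: box_def)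
  finally show "ent ((W i)\<^sup>T * X) p q = ent (tzero K1 K2 L1 L2) p q"
    using pq by (simp add: ent_tzero)
qed (use W[OF i] X in \<open>auto simp: tensors_iff\<close>)

text \<open>The product of the two concatenations is a block matrix with blocks
  \<open>(W i)\<^sup>T * V j\<close>: identities on the diagonal, zeros elsewhere.\<close>

lemma tconcat_biorthonormal:
  fixes V W :: "nat \<Rightarrow> 'a::comm_ring_1 tensor4"
  assumes V: "\<And>i. i \<in> {1..k} \<Longrightarrow> V i \<in> tensors J1 J2 K1 K2"
    and W: "\<And>i. i \<in> {1..k} \<Longrightarrow> W i \<in> tensors J1 J2 K1 K2" and k: "k \<ge> 1"
    and VW: "\<And>i j. i \<in> {1..k} \<Longrightarrow> j \<in> {1..k} \<Longrightarrow>
      (W i)\<^sup>T * V j = (if i = j then tident K1 K2 else tzero K1 K2 K1 K2)"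
  shows "(tconcat k W)\<^sup>T * tconcat k V = tident K1 (k * K2)"
proof (rule tensor_eqI)
  have V1: "rdim (V 1) = (J1, J2)" "cdim (V 1) = (K1, K2)"
    and W1: "rdim (W 1) = (J1, J2)" "cdim (W 1) = (K1, K2)"
    using V[of 1] W[of 1] k by (auto simp: tensors_iff)
  fix p q assume "p \<in> box (rdim (tident K1 (k * K2) :: 'a tensor4))"
    "q \<in> box (cdim (tident K1 (k * K2) :: 'a tensor4))"
  then obtain p1 p2 q1 q2 where pq: "p = (p1, p2)" "q = (q1, q2)"
      "p1 < K1" "q1 < K1" "p2 < k * K2" "q2 < k * K2"
    by (auto simp: box_def)
  define i j where "i = p2 div K2 + 1" and "j = q2 div K2 + 1"
  have ij: "i \<in> {1..k}" "j \<in> {1..k}"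
    using pq by (auto simp: i_def j_def Suc_le_eq less_mult_imp_div_less)
  have K2: "K2 > 0"
    using pq by (cases "K2 = 0") auto
  then have m: "p2 mod K2 < K2" "q2 mod K2 < K2"
    by auto
  have d: "rdim (W i) = (J1, J2)" "cdim (W i) = (K1, K2)" "cdim (V j) = (K1, K2)"
    using V[of j] W[of i] ij by (auto simp: tensors_iff)
  have b: "(q1, q2) \<in> box (K1, k * K2)" "(p1, p2 mod K2) \<in> box (K1, K2)"
    "(q1, q2 mod K2) \<in> box (K1, K2)"
    using pq m by (auto simp: box_def)
  have "ent ((tconcat k W)\<^sup>T * tconcat k V) p q
      = ent ((W i)\<^sup>T * tconcat k V) (p1, p2 mod K2) (q1, q2)"
    unfolding pq i_def using pq V1 b by (intro tconcat_transpose_times[OF W k]) auto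
  also have "\<dots> = ent ((W i)\<^sup>T * V j) (p1, p2 mod K2) (q1, q2 mod K2)"
    using d b V1 pq by (simp add: ent_times ent_tconcat[of _ _ K1 K2] j_def)
  also have "\<dots> = (if i = j \<and> p1 = q1 \<and> p2 mod K2 = q2 mod K2 then 1 else 0)"
    using VW[OF ij] b by (simp add: ent_tident ent_tzero)
  \<comment> \<open>Quotient and remainder by \<open>K2\<close> together determine an index, so
    agreeing in block and in position within the block means being equal.\<close>
  also have "(i = j \<and> p1 = q1 \<and> p2 mod K2 = q2 mod K2) \<longleftrightarrow> p = q"
    unfolding i_def j_def pq by (metis add_right_cancel div_mult_mod_eq prod.inject)
  finally show "ent ((tconcat k W)\<^sup>T * tconcat k V) p q = ent (tident K1 (k * K2)) p q"
    using pq by (subst ent_tident) (auto simp: box_def)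
qed (use V[of 1] W[of 1] k in \<open>auto simp: tensors_iff\<close>)

text \<open>Subtracting \<open>tconcat k V * ((tconcat k W)\<^sup>T * S)\<close> removes from
  \<open>S\<close> exactly what the earlier left blocks see; cancelling \<open>H\<close> transfers
  this to the new block \<open>X\<close>. With \<open>V\<close> and \<open>W\<close> exchanged, the
  same lemma serves the left recursion.\<close>

lemma lanczos_step_orthogonal:
  fixes V W :: "nat \<Rightarrow> 'a::comm_ring_1 tensor4"
  assumes V: "\<And>i. i \<in> {1..k} \<Longrightarrow> V i \<in> tensors J1 J2 K1 K2"
    and W: "\<And>i. i \<in> {1..k} \<Longrightarrow> W i \<in> tensors J1 J2 K1 K2"
    and VW: "\<And>i j. i \<in> {1..k} \<Longrightarrow> j \<in> {1..k} \<Longrightarrow>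
      (W i)\<^sup>T * V j = (if i = j then tident K1 K2 else tzero K1 K2 K1 K2)"
    and S: "S \<in> tensors J1 J2 K1 K2" and X: "X \<in> tensors J1 J2 K1 K2"
    and H: "H \<in> tensors K1 K2 K1 K2" "tinvertible H"
    and step: "S - tconcat k V * ((tconcat k W)\<^sup>T * S) = X * H"
    and i: "i \<in> {1..k}"
  shows "(W i)\<^sup>T * X = tzero K1 K2 K1 K2"
proof (rule transpose_times_eq_tzero_of_tconcat[OF W X _ i])
  have k: "k \<ge> 1"
    using i by simp
  let ?V = "tconcat k V" and ?W = "tconcat k W"
  have V1: "rdim (V 1) = (J1, J2)" "cdim (V 1) = (K1, K2)"
    and W1: "rdim (W 1) = (J1, J2)" "cdim (W 1) = (K1, K2)"
    using V[of 1] W[of 1] k by (auto simp: tensors_iff)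
  note d = V1 W1 S[unfolded tensors_iff] X[unfolded tensors_iff] H(1)[unfolded tensors_iff]
  have VWk: "?W\<^sup>T * ?V = tident K1 (k * K2)"
    by (rule tconcat_biorthonormal[OF V W k VW])
  have "?W\<^sup>T * X * H = ?W\<^sup>T * (S - ?V * (?W\<^sup>T * S))"
    unfolding step using d by (simp add: times_assoc)
  \<comment> \<open>Regrouping exposes \<open>?W\<^sup>T * ?V\<close>, which is the identity, so the
    two terms agree.\<close>
  also have "\<dots> = ?W\<^sup>T * S - ?W\<^sup>T * ?V * (?W\<^sup>T * S)"
    using d by (simp add: times_minus_distrib_left times_assoc)
  also have "\<dots> = ?W\<^sup>T * S - ?W\<^sup>T * S"
    unfolding VWk using d by simp
  also have "\<dots> = tzero K1 (k * K2) K1 K2"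
    using d by (intro minus_self) simp_all
  finally show "?W\<^sup>T * X = tzero K1 (k * K2) K1 K2"
    using d by - (rule times_tinvertible_eq_tzero[OF H(2)], simp_all)
qed

text \<open>At a finite point the operator is a \<open>tinv\<close>, whose size is known only once
  an inverse exists; at infinity it is \<open>A\<close> itself.\<close>

lemma dim_krylov_op:
  assumes "A \<in> tensors J1 J2 J1 J2"
    and "\<And>x. c = Finite x \<Longrightarrow> tinvertible (A - x \<cdot> tident J1 J2)"
  shows "rdim (krylov_op J1 J2 A c) = (J1, J2)" "cdim (krylov_op J1 J2 A c) = (J1, J2)"
proof -
  have "rdim (krylov_op J1 J2 A c) = (J1, J2) \<and> cdim (krylov_op J1 J2 A c) = (J1, J2)"
  proof (cases c)
    case (Finite x)
    then show ?thesis
      using assms tinv(1,2)[OF assms(2)[OF Finite], of J1 J2] by (simp add: tensors_iff)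
  next
    case Infinity
    then show ?thesis
      using assms(1) by (simp add: tensors_iff)
  qed
  then show "rdim (krylov_op J1 J2 A c) = (J1, J2)" "cdim (krylov_op J1 J2 A c) = (J1, J2)"
    by auto
qed

text \<open>Induction on the number \<open>k\<close> of blocks. The diagonal products are normalized
  by the process itself, so only the mixed products of the newest block with earlier ones require an
  argument.\<close>

lemma lanczos_biorthogonal:
  assumes A: "A \<in> tensors J1 J2 J1 J2"
    and lanczos: "rational_block_lanczos J1 J2 K1 K2 A B C \<sigma> m V W H G"
    and "k \<le> m" "i \<in> {1..k}" "j \<in> {1..k}"
  shows "(W i)\<^sup>T * V j = (if i = j then tident K1 K2 else tzero K1 K2 K1 K2)"
  using assms(3-)
proof (induction k arbitrary: i j)
  case 0
  then show ?case by simp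
next
  case (Suc k)
  note L = lanczos[unfolded rational_block_lanczos_def Let_def]
  have V: "V i \<in> tensors J1 J2 K1 K2" and W: "W i \<in> tensors J1 J2 K1 K2"
    and diag: "(W i)\<^sup>T * V i = tident K1 K2" if "i \<in> {1..Suc k}" for i
    using L that \<open>Suc k \<le> m\<close> by auto
  have IH: "(W i)\<^sup>T * V j = (if i = j then tident K1 K2 else tzero K1 K2 K1 K2)"
    if "i \<in> {1..k}" "j \<in> {1..k}" for i j
    using Suc.IH that \<open>Suc k \<le> m\<close> by simp
  \<comment> \<open>The left recursion projects with the roles of \<open>V\<close> and
    \<open>W\<close> exchanged, so the induction hypothesis is also needed in transposed
    form.\<close>
  have IH': "(V i)\<^sup>T * W j = (if i = j then tident K1 K2 else tzero K1 K2 K1 K2)"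
    if "i \<in> {1..k}" "j \<in> {1..k}" for i j
  proof -
    have "(V i)\<^sup>T * W j = ((W j)\<^sup>T * V i)\<^sup>T"
      using V[of i] W[of j] that by (simp add: ttranspose_times tensors_iff)
    then show ?thesis
      using IH[OF that(2,1)] by auto
  qed
  have new: "(W l)\<^sup>T * V (Suc k) = tzero K1 K2 K1 K2"
    "(W (Suc k))\<^sup>T * V l = tzero K1 K2 K1 K2" if l: "l \<in> {1..k}" for l
  proof -
    let ?K = "krylov_op J1 J2 A (\<sigma> (k + 1))"
    \<comment> \<open>The existence of \<open>l\<close> forces \<open>k \<ge> 1\<close>, so block
      \<open>k + 1\<close> comes from a genuine recursion step and not from the initial
      factorizations.\<close>
    have k: "k \<in> {1..<m}" "k \<in> {0..<m}" "k + 1 \<in> {1..m}"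
      using l \<open>Suc k \<le> m\<close> by auto
    have K: "rdim ?K = (J1, J2)" "cdim ?K = (J1, J2)"
      using dim_krylov_op[OF A, of "\<sigma> (k + 1)"] L k(3) by blast+
    have HG: "H (k + 1) k \<in> tensors K1 K2 K1 K2" "G (k + 1) k \<in> tensors K1 K2 K1 K2"
      using L k(2) by blast+
    have st: "?K * V k - tconcat k V * ((tconcat k W)\<^sup>T * (?K * V k)) = V (k + 1) * H (k + 1) k"
      "?K\<^sup>T * W k - tconcat k W * ((tconcat k V)\<^sup>T * (?K\<^sup>T * W k)) = W (k + 1) * G (k + 1) k"
      "tinvertible (H (k + 1) k)" "tinvertible (G (k + 1) k)"
      using L k(1) by blast+
    have VWk: "?K * V k \<in> tensors J1 J2 K1 K2" "?K\<^sup>T * W k \<in> tensors J1 J2 K1 K2"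
      using V[of k] W[of k] K l by (auto simp: tensors_iff)
    have d: "V (k + 1) \<in> tensors J1 J2 K1 K2" "W (k + 1) \<in> tensors J1 J2 K1 K2"
      using V[of "Suc k"] W[of "Suc k"] by auto
    have "(W l)\<^sup>T * V (k + 1) = tzero K1 K2 K1 K2"
      by (rule lanczos_step_orthogonal[OF V W IH VWk(1) d(1) HG(1) st(3,1) l]) auto
    then show "(W l)\<^sup>T * V (Suc k) = tzero K1 K2 K1 K2"
      by simp
    have "(V l)\<^sup>T * W (k + 1) = tzero K1 K2 K1 K2"
      by (rule lanczos_step_orthogonal[OF W V IH' VWk(2) d(2) HG(2) st(4,2) l]) auto
    \<comment> \<open>The left recursion yields the product in the order \<open>V\<close>,
      \<open>W\<close>; transposing restores the order of the claim.\<close>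
    moreover have "(W (k + 1))\<^sup>T * V l = ((V l)\<^sup>T * W (k + 1))\<^sup>T"
      using V[of l] d l by (simp add: ttranspose_times tensors_iff)
    ultimately show "(W (Suc k))\<^sup>T * V l = tzero K1 K2 K1 K2"
      by simp
  qed
  \<comment> \<open>Two old blocks fall under \<open>IH\<close>, one old and one new under
    \<open>new\<close>, and two new ones under \<open>diag\<close>.\<close>
  show ?case
    using Suc.prems IH[of i j] new[of i] new[of j] diag[of i]
    by (cases "i = Suc k"; cases "j = Suc k") auto
qed

section \<open>Petrov--Galerkin projection\<close>

text \<open>The last hypothesis is the reduced equation, which makes both terms of the projected
  residual coincide. It is applied to the right residual, and to the left one with \<open>M\<close>
  transposed and \<open>V\<close>, \<open>W\<close> exchanged.\<close>

lemma galerkin_residual: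
  fixes M V W B X :: "'a::comm_ring_1 tensor4"
  assumes "rdim M = (J1, J2)" "cdim M = (J1, J2)" "rdim V = (J1, J2)" "cdim V = (L1, L2)"
    "rdim W = (J1, J2)" "cdim W = (L1, L2)" "rdim B = (J1, J2)" "cdim B = (K1, K2)"
    "rdim X = (L1, L2)" "cdim X = (K1, K2)"
    and "W\<^sup>T * M * V * X = W\<^sup>T * B"
  shows "W\<^sup>T * (B - M * V * X) = tzero L1 L2 K1 K2"
  using assms by (simp add: times_minus_distrib_left times_assoc minus_self)

text \<open>Transposing the left residual puts \<open>M\<close> next to \<open>tinv M\<close>. They
  cancel, so the correction becomes \<open>Y\<^sup>T * (W\<^sup>T * R)\<close>, which the Galerkin
  condition kills; then \<open>R\<close> is expanded in the remaining term
  \<open>C * tinv M * R\<close>.\<close>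

lemma residual_product:
  fixes M V W B C X Y :: "'a::comm_ring_1 tensor4"
  assumes M: "tinvertible M" "rdim M = (J1, J2)"
    and d: "rdim V = (J1, J2)" "cdim V = (L1, L2)" "rdim W = (J1, J2)" "cdim W = (L1, L2)"
      "rdim B = (J1, J2)" "cdim B = (K1, K2)" "rdim C = (K1, K2)" "cdim C = (J1, J2)"
      "rdim X = (L1, L2)" "cdim X = (K1, K2)" "rdim Y = (L1, L2)" "cdim Y = (K1, K2)"
    and R: "R = B - M * V * X" and galerkin: "W\<^sup>T * R = tzero L1 L2 K1 K2"
  shows "(C\<^sup>T - M\<^sup>T * W * Y)\<^sup>T * tinv M * R = C * tinv M * B - C * V * X"
proof -
  note i = tinv[OF M]
  have "(C\<^sup>T - M\<^sup>T * W * Y)\<^sup>T = C - Y\<^sup>T * (W\<^sup>T * M)"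
    using M d i by (simp add: ttranspose_minus ttranspose_times)
  then have "(C\<^sup>T - M\<^sup>T * W * Y)\<^sup>T * tinv M * R
      = C * tinv M * R - Y\<^sup>T * (W\<^sup>T * (M * tinv M * R))"
    using M d i R by (simp add: times_minus_distrib_right times_assoc)
  also have "\<dots> = C * tinv M * R - Y\<^sup>T * tzero L1 L2 K1 K2"
    using M d i galerkin by (simp add: R)
  also have "\<dots> = C * tinv M * R"
    using M d i by (simp add: R times_tzero minus_tzero)
  also have "\<dots> = C * tinv M * B - C * (tinv M * (M * (V * X)))"
    using M d i by (simp add: R times_minus_distrib_left times_assoc)
  also have "tinv M * (M * (V * X)) = V * X"
    using M d by (intro tinv_times_eqI) simp_all
  also have "C * (V * X) = C * V * X"
    using d by (simp add: times_assoc)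
  finally show ?thesis .
qed

theorem theorem3p3:
  fixes J1 J2 K1 K2 m :: nat
    and A B C :: "real tensor4"
    and \<sigma> :: "nat \<Rightarrow> interp_point"
    and V W :: "nat \<Rightarrow> real tensor4"
    and H G :: "nat \<Rightarrow> nat \<Rightarrow> real tensor4"
    and Vm Wm Am Bm Cm :: "real tensor4"
    and s :: complex
    and XB XC RB RC :: "complex tensor4"
  assumes A: "A \<in> tensors J1 J2 J1 J2"
    and B: "B \<in> tensors J1 J2 K1 K2"
    and C: "C \<in> tensors K1 K2 J1 J2"
    and m: "m \<ge> 1"
    and lanczos: "rational_block_lanczos J1 J2 K1 K2 A B C \<sigma> m V W H G"
    and Vm: "Vm = tconcat m V"
    and Wm: "Wm = tconcat m W"
    and Am: "Am = Wm\<^sup>T * A * Vm"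
    and Bm: "Bm = Wm\<^sup>T * B"
    and Cm: "Cm = C * Vm"
    and inv: "tinvertible (s \<cdot> tident J1 J2 - complex_tensor A)"
    and inv_m: "tinvertible (s \<cdot> tident K1 (m * K2) - complex_tensor Am)"
    and XB: "XB \<in> tensors K1 (m * K2) K1 K2"
      "(s \<cdot> tident K1 (m * K2) - complex_tensor Am) * XB = complex_tensor Bm"
    and XC: "XC \<in> tensors K1 (m * K2) K1 K2"
      "(s \<cdot> tident K1 (m * K2) - complex_tensor Am)\<^sup>T * XC = complex_tensor (Cm\<^sup>T)"
    and RB: "RB = complex_tensor B
      - (s \<cdot> tident J1 J2 - complex_tensor A) * complex_tensor Vm * XB"
    and RC: "RC = complex_tensor (C\<^sup>T)
      - (s \<cdot> tident J1 J2 - complex_tensor A)\<^sup>T * complex_tensor Wm * XC"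
  shows "complex_tensor (Wm\<^sup>T) * RB = tzero K1 (m * K2) K1 K2 \<and>
    complex_tensor (Vm\<^sup>T) * RC = tzero K1 (m * K2) K1 K2 \<and>
    transfer_function J1 J2 A B C s - transfer_function K1 (m * K2) Am Bm Cm s
      = RC\<^sup>T * tinv (s \<cdot> tident J1 J2 - complex_tensor A) * RB"
proof -
  let ?c = complex_tensor
  let ?M = "s \<cdot> tident J1 J2 - ?c A"
  let ?Mm = "s \<cdot> tident K1 (m * K2) - ?c Am"
  note L = lanczos[unfolded rational_block_lanczos_def]
  have VWk: "V i \<in> tensors J1 J2 K1 K2" "W i \<in> tensors J1 J2 K1 K2" if "i \<in> {1..m}" for i
    using L that by blast+
  have "Wm\<^sup>T * Vm = tident K1 (m * K2)"
    unfolding Vm Wm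
    using tconcat_biorthonormal[OF VWk m lanczos_biorthogonal[OF A lanczos order_refl]] .
  moreover have dV: "rdim Vm = (J1, J2)" "cdim Vm = (K1, m * K2)"
    and dW: "rdim Wm = (J1, J2)" "cdim Wm = (K1, m * K2)"
    using VWk[of 1] m by (auto simp: Vm Wm tensors_iff)
  ultimately have biorth: "(?c Wm)\<^sup>T * ?c Vm = tident K1 (m * K2)"
    by (metis complex_tensor_times complex_tensor_ttranspose complex_tensor_tident
        dim_ttranspose(2))
  note d = dV dW A[unfolded tensors_iff] B[unfolded tensors_iff] C[unfolded tensors_iff]
    XB(1)[unfolded tensors_iff] XC(1)[unfolded tensors_iff]
  have dM: "rdim ?M = (J1, J2)" "cdim ?M = (J1, J2)"
    by simp_all
  \<comment> \<open>After distributing, the term with \<open>s\<close> contains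
    \<open>(?c Wm)\<^sup>T * ?c Vm\<close>, which \<open>biorth\<close> replaces by the reduced
    identity.\<close>
  have Mm: "?Mm = (?c Wm)\<^sup>T * ?M * ?c Vm"
    using d biorth
    by (simp add: Am complex_tensor_times complex_tensor_ttranspose times_minus_distrib_left
        times_minus_distrib_right times_assoc tscale_times times_tscale)
  \<comment> \<open>Transposition exchanges the two bases, giving the adjoint reduced equation the
    form that \<open>galerkin_residual\<close> expects.\<close>
  have MmT: "?Mm\<^sup>T = (?c Vm)\<^sup>T * ?M\<^sup>T * ?c Wm"
    unfolding Mm using d by (simp add: ttranspose_times times_assoc)
  have WRB: "(?c Wm)\<^sup>T * RB = tzero K1 (m * K2) K1 K2"
    unfolding RB using d XB(2)[unfolded Mm]
    by (intro galerkin_residual[of _ J1 J2])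
      (simp_all add: Bm complex_tensor_times complex_tensor_ttranspose)
  have VRC: "(?c Vm)\<^sup>T * RC = tzero K1 (m * K2) K1 K2"
    unfolding RC using d XC(2)[unfolded MmT]
    by (intro galerkin_residual[of _ J1 J2])
      (simp_all add: Cm ttranspose_times complex_tensor_times complex_tensor_ttranspose)
  have "RC\<^sup>T * tinv ?M * RB = ?c C * tinv ?M * ?c B - ?c C * ?c Vm * XB"
    unfolding RC complex_tensor_ttranspose using d dM WRB
    by (intro residual_product[OF inv, where W = "?c Wm" and ?L1.0 = K1 and ?L2.0 = "m * K2"] RB)
      simp_all
  \<comment> \<open>Since \<open>XB\<close> solves the reduced system, it equals
    \<open>tinv ?Mm * ?c Bm\<close>, and the subtracted term becomes the reduced transfer
    function.\<close>
  also have "?c C * ?c Vm * XB = ?c Cm * (tinv ?Mm * ?c Bm)"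
    using tinv_times_eqI[OF inv_m _ XB(2)] d by (simp add: Cm complex_tensor_times)
  also have "\<dots> = ?c Cm * tinv ?Mm * ?c Bm"
    using tinv(1,2)[OF inv_m, of K1 "m * K2"] d by (subst times_assoc) (simp_all add: Cm Bm)
  finally show ?thesis
    using WRB VRC by (simp add: complex_tensor_ttranspose transfer_function_def)
qed

end
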